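(* $h_{\mathrm{Tour}} (\kappa)= \log_2(\kappa)$ if $\kappa$ is an infinite cardinal and $h_{\mathrm{Tour}} (\kappa)= \lceil \log_2(\kappa\cdot(\kappa-1)) \rceil$ if $\kappa$ is a non negative integer.
   Context: Let $V$ be a set of cardinality $\kappa$ and let $\mathrm{Tour}(V)$ be the set of tournaments on $V$ (irreflexive binary relations $\tau$ such that for every ordered pair $(x,y)$ of distinct elements exactly one of $(x,y)$, $(y,x)$ belongs to $\tau$). A tournament $\tau$ separates two distinct ordered pairs $(x,y),(x',y')\in V\times V\setminus\Delta_V$ if $\tau(x,y)\neq\tau(x',y')$ (identifying $\tau$ with its characteristic function). $h_{\mathrm{Tour}}(\kappa)$ is the least cardinal $\mu$ such that there is a subset $X\subseteq \mathrm{Tour}(V)$ of cardinality $\mu$ such that any two distinct ordered pairs in $V\times V\setminus\Delta_V$ are separated by some member of $X$. For an infinite cardinal $\kappa$, $\log_2(\kappa)$ is the least cardinal $\mu$ with $\kappa\le 2^\mu$; for integers it is the ordinary logarithm. *)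

theory Defs
  imports Complex_Main
begin

unbundle cardinal_syntax

(* Cardinals are represented as in HOL's cardinal library: relations r with Card_order r,
   taken up to the isomorphism =o and compared by \<le>o. *)

(* \<nu> ranges over the cardinals of type 'a only, but for the properties P used below (invariant
   under =o across types) this is minimality among all cardinals: a cardinal smaller than one
   of type 'a is itself representable in type 'a. *)
definition least_cardinal :: "('a rel \<Rightarrow> bool) \<Rightarrow> 'a rel" where
  "least_cardinal P =
     (SOME \<mu>. Card_order \<mu> \<and> P \<mu> \<and> (\<forall>\<nu>. Card_order \<nu> \<and> P \<nu> \<longrightarrow> \<mu> \<le>o \<nu>))"

definition Tour :: "'a set \<Rightarrow> 'a rel set" where
  "Tour V = {\<tau>. \<tau> \<subseteq> V \<times> V \<and> irrefl \<tau> \<and>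
     (\<forall>x\<in>V. \<forall>y\<in>V. x \<noteq> y \<longrightarrow> ((x, y) \<in> \<tau> \<longleftrightarrow> (y, x) \<notin> \<tau>))}"

definition separates :: "'a rel \<Rightarrow> 'a \<times> 'a \<Rightarrow> 'a \<times> 'a \<Rightarrow> bool" where
  "separates \<tau> p q \<longleftrightarrow> (p \<in> \<tau>) \<noteq> (q \<in> \<tau>)"

definition separating_family :: "'a set \<Rightarrow> 'a rel set \<Rightarrow> bool" where
  "separating_family V X \<longleftrightarrow> X \<subseteq> Tour V \<and>
     (\<forall>p \<in> V \<times> V - Id. \<forall>q \<in> V \<times> V - Id. p \<noteq> q \<longrightarrow> (\<exists>\<tau>\<in>X. separates \<tau> p q))"

(* Meaningful for Card_order \<kappa>.  The type of the value is large enough: X is a set of relations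
   on 'a, so every cardinality |X| is a cardinal of the type ('a rel) rel. *)
definition h_Tour :: "'a rel \<Rightarrow> 'a rel rel" where
  "h_Tour \<kappa> = least_cardinal
     (\<lambda>\<mu>. \<exists>V X. |V :: 'a set| =o \<kappa> \<and> separating_family V X \<and> |X| =o \<mu>)"

(* Since \<kappa> \<le>o ctwo ^c \<kappa>, the least such \<mu> exists in the type of \<kappa>. *)
definition log2_card :: "'a rel \<Rightarrow> 'a rel" where
  "log2_card \<kappa> = least_cardinal (\<lambda>\<mu>. \<kappa> \<le>o ctwo ^c \<mu>)"

lemma least_cardinal_props:
  assumes "Card_order \<mu>0" "P \<mu>0"
  shows "Card_order (least_cardinal P)" "P (least_cardinal P)"
    "\<And>\<nu>. Card_order \<nu> \<Longrightarrow> P \<nu> \<Longrightarrow> least_cardinal P \<le>o \<nu>"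
proof -
  let ?R = "{\<nu>. Card_order \<nu> \<and> P \<nu>}"
  have "?R \<noteq> {}" "\<forall>r\<in>?R. Card_order r" using assms by auto
  then have "\<exists>r\<in>?R. \<forall>r'\<in>?R. r \<le>o r'" by (rule exists_minim_Card_order)
  then have "\<exists>\<mu>. Card_order \<mu> \<and> P \<mu> \<and> (\<forall>\<nu>. Card_order \<nu> \<and> P \<nu> \<longrightarrow> \<mu> \<le>o \<nu>)" by blast
  then have *: "Card_order (least_cardinal P) \<and> P (least_cardinal P) \<and>
      (\<forall>\<nu>. Card_order \<nu> \<and> P \<nu> \<longrightarrow> least_cardinal P \<le>o \<nu>)"
    unfolding least_cardinal_def by (rule someI_ex)
  from * show "Card_order (least_cardinal P)" ..
  from * show "P (least_cardinal P)" by (elim conjE)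
  show "least_cardinal P \<le>o \<nu>" if "Card_order \<nu>" "P \<nu>" for \<nu>
    using * that by (elim conjE allE[of _ \<nu>] impE) (intro conjI)
qed

lemma Tour_nonempty: "\<exists>\<tau>. \<tau> \<in> Tour V"
proof -
  obtain r where r: "well_order_on V r" using well_order_on by blast
  then have "total_on V r" "antisym r" "r \<subseteq> V \<times> V"
    by (auto simp: well_order_on_def linear_order_on_def partial_order_on_def
        preorder_on_def refl_on_def)
  then have "r - Id \<in> Tour V"
    by (auto simp: Tour_def irrefl_def total_on_def antisym_def)
  then show ?thesis ..
qed

lemma Tour_reverse:
  assumes "\<tau> \<in> Tour V" "x \<in> V" "y \<in> V" "x \<noteq> y"
  shows "insert (x, y) (\<tau> - {(y, x)}) \<in> Tour V"
proof -
  let ?\<sigma> = "insert (x, y) (\<tau> - {(y, x)})"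
  have \<tau>: "\<tau> \<subseteq> V \<times> V" "irrefl \<tau>"
      "\<And>a b. a \<in> V \<Longrightarrow> b \<in> V \<Longrightarrow> a \<noteq> b \<Longrightarrow> (a, b) \<in> \<tau> \<longleftrightarrow> (b, a) \<notin> \<tau>"
    using assms(1) unfolding Tour_def by blast+
  have "?\<sigma> \<subseteq> V \<times> V" using \<tau>(1) assms(2,3) by blast
  moreover have "irrefl ?\<sigma>" using \<tau>(2) \<open>x \<noteq> y\<close> by (simp add: irrefl_def)
  moreover have "(a, b) \<in> ?\<sigma> \<longleftrightarrow> (b, a) \<notin> ?\<sigma>" if "a \<in> V" "b \<in> V" "a \<noteq> b" for a b
    using \<tau>(3)[OF that] \<open>x \<noteq> y\<close> by (simp only: insert_iff Diff_iff empty_iff prod.inject) blast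
  ultimately show ?thesis unfolding Tour_def by blast
qed

lemma separating_family_Tour: "separating_family V (Tour V)"
  unfolding separating_family_def
proof (intro conjI ballI impI subset_refl)
  fix p q assume p: "p \<in> V \<times> V - Id" and q: "q \<in> V \<times> V - Id" and "p \<noteq> q"
  obtain x y x' y' where [simp]: "p = (x, y)" "q = (x', y')" by (metis surj_pair)
  obtain \<tau> where \<tau>: "\<tau> \<in> Tour V" using Tour_nonempty by blast
  let ?\<tau>1 = "insert (x, y) (\<tau> - {(y, x)})"
  let ?\<tau>2 = "insert (y', x') (?\<tau>1 - {(x', y')})"
  have "?\<tau>1 \<in> Tour V" by (rule Tour_reverse) (use \<tau> p in auto)
  then have "?\<tau>2 \<in> Tour V" by (rule Tour_reverse) (use q in auto)
  moreover have "separates ?\<tau>2 p q"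
    using p q \<open>p \<noteq> q\<close> by (auto simp: separates_def)
  ultimately show "\<exists>\<tau>\<in>Tour V. separates \<tau> p q" by blast
qed

lemma h_Tour_props:
  fixes \<kappa> :: "'a rel"
  assumes "Card_order \<kappa>"
  shows "Card_order (h_Tour \<kappa>)"
    "\<exists>V X. |V :: 'a set| =o \<kappa> \<and> separating_family V X \<and> |X| =o h_Tour \<kappa>"
    "\<And>(V :: 'a set) X. |V| =o \<kappa> \<Longrightarrow> separating_family V X \<Longrightarrow> h_Tour \<kappa> \<le>o |X|"
proof -
  let ?P = "\<lambda>\<mu>. \<exists>V X. |V :: 'a set| =o \<kappa> \<and> separating_family V X \<and> |X| =o \<mu>"
  have "?P |Tour (Field \<kappa>)|"
    by (intro exI conjI, rule card_of_Field_ordIso[OF assms], rule separating_family_Tour,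
        rule card_of_refl)
  note * = least_cardinal_props[where P = ?P, OF card_of_Card_order this, folded h_Tour_def]
  show "Card_order (h_Tour \<kappa>)"
    "\<exists>V X. |V :: 'a set| =o \<kappa> \<and> separating_family V X \<and> |X| =o h_Tour \<kappa>"
    by (fact *(1), fact *(2))
  show "h_Tour \<kappa> \<le>o |X|" if "|V| =o \<kappa>" "separating_family V X" for V :: "'a set" and X
  proof (rule *(3))
    show "?P |X|" using that card_of_refl[of X] by (intro exI conjI)
  qed (rule card_of_Card_order)
qed

lemma log2_card_props:
  fixes \<kappa> :: "'a rel"
  assumes "Card_order \<kappa>"
  shows "Card_order (log2_card \<kappa>)" "\<kappa> \<le>o ctwo ^c log2_card \<kappa>"
    "\<And>\<nu> :: 'a rel. Card_order \<nu> \<Longrightarrow> \<kappa> \<le>o ctwo ^c \<nu> \<Longrightarrow> log2_card \<kappa> \<le>o \<nu>"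
proof -
  have "\<kappa> \<le>o ctwo ^c \<kappa>"
    using ordLess_ctwo_cexp[OF assms] ordLess_imp_ordLeq by blast
  note * = least_cardinal_props[where P = "\<lambda>\<mu>. \<kappa> \<le>o ctwo ^c \<mu>", OF assms this,
      folded log2_card_def]
  show "Card_order (log2_card \<kappa>)" "\<kappa> \<le>o ctwo ^c log2_card \<kappa>"
    "\<And>\<nu> :: 'a rel. Card_order \<nu> \<Longrightarrow> \<kappa> \<le>o ctwo ^c \<nu> \<Longrightarrow> log2_card \<kappa> \<le>o \<nu>"
    by (fact *)+
qed

(* For n \<le> 1 there are no pairs to separate and n(n-1) = 0; HOL's convention log 2 0 = 0 makes
   the formula \<lceil>log 2 (n(n-1))\<rceil> give the value 0 there, as it should. *)
lemma log_pairs_degenerate: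
  "n \<le> 1 \<Longrightarrow> nat \<lceil>log 2 (real n * (real n - 1))\<rceil> = 0" for n :: nat
  by (cases n) (auto simp: log_def)

end

theory Submission
  imports Defs
begin

text \<open>
  Sending a pair \<open>p\<close> to the set of members of a separating family \<open>X\<close> that contain it is an
  injection of the set of pairs into \<open>Pow X\<close>, which gives the lower bound. For the upper bound fix
  one tournament \<open>R\<close> and an injection \<open>g\<close> of \<open>R\<close> into \<open>Pow I\<close>. Each \<open>i \<in> I\<close> yields the tournament
  obtained from \<open>R\<close> by reversing the arcs \<open>p\<close> with \<open>i \<notin> g p\<close>; together with \<open>R\<close> itself these
  separate all pairs. In the finite case \<open>R\<close> contains half of the pairs, so that \<open>I\<close> needs one
  element less than a set whose power set has room for all pairs, and \<open>R\<close> compensates for it exactly.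
\<close>

lemma TourD:
  assumes "R \<in> Tour V"
  shows "R \<subseteq> V \<times> V" "(x, x) \<notin> R"
    "x \<in> V \<Longrightarrow> y \<in> V \<Longrightarrow> x \<noteq> y \<Longrightarrow> (x, y) \<in> R \<longleftrightarrow> (y, x) \<notin> R"
proof -
  have R: "R \<subseteq> V \<times> V \<and> irrefl R \<and>
      (\<forall>x\<in>V. \<forall>y\<in>V. x \<noteq> y \<longrightarrow> ((x, y) \<in> R \<longleftrightarrow> (y, x) \<notin> R))"
    using assms unfolding Tour_def mem_Collect_eq .
  show "R \<subseteq> V \<times> V" by (rule R[THEN conjunct1])
  show "(x, x) \<notin> R" using R[THEN conjunct2, THEN conjunct1] by (simp add: irrefl_def)
  show "(x, y) \<in> R \<longleftrightarrow> (y, x) \<notin> R" if "x \<in> V" "y \<in> V" "x \<noteq> y"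
    by (rule R[THEN conjunct2, THEN conjunct2, rule_format, OF that])
qed

lemma separating_family_pairs_ordLeq_Pow:
  assumes "separating_family V X"
  shows "|V \<times> V - Id| \<le>o |Pow X|"
proof -
  have "inj_on (\<lambda>p. {\<tau> \<in> X. p \<in> \<tau>}) (V \<times> V - Id)"
  proof (rule inj_onI, rule ccontr)
    fix p q
    assume "p \<in> V \<times> V - Id" "q \<in> V \<times> V - Id" "p \<noteq> q"
    with assms obtain \<tau> where "\<tau> \<in> X" "separates \<tau> p q"
      unfolding separating_family_def by blast
    moreover assume "{\<tau> \<in> X. p \<in> \<tau>} = {\<tau> \<in> X. q \<in> \<tau>}"
    ultimately show False by (auto simp: separates_def)
  qed
  then show ?thesis by (intro card_of_ordLeqI) auto
qed

text \<open>When \<open>R\<close> is a tournament, \<open>g p\<close> can be read off for each arc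
  \<open>p\<close> of \<open>R\<close>: it is the set of indices whose tournament keeps
  \<open>p\<close>.\<close>

definition reorient :: "'a rel \<Rightarrow> ('a \<times> 'a \<Rightarrow> 'i set) \<Rightarrow> 'i \<Rightarrow> 'a rel" where
  "reorient R g i = {p \<in> R. i \<in> g p} \<union> {p \<in> R. i \<notin> g p}\<inverse>"

lemma reorient_Tour:
  assumes "R \<in> Tour V"
  shows "reorient R g i \<in> Tour V"
proof -
  note R = TourD[OF assms]
  have "reorient R g i \<subseteq> V \<times> V" "irrefl (reorient R g i)"
    using R(1,2) by (auto simp: reorient_def irrefl_def)
  moreover have "(x, y) \<in> reorient R g i \<longleftrightarrow> (y, x) \<notin> reorient R g i"
    if "x \<in> V" "y \<in> V" "x \<noteq> y" for x y
    using R(3)[OF that] by (auto simp: reorient_def)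
  ultimately show ?thesis unfolding Tour_def by blast
qed

text \<open>Two arcs of \<open>R\<close> are told apart by an index on which their codes differ. Two
  pairs outside \<open>R\<close> reduce to their converses, since passing to the converse
  complements membership. A mixed couple may have complementary codes, whence \<open>R\<close>
  itself joins the family.\<close>

lemma separating_family_reorient:
  assumes R: "R \<in> Tour V" and inj: "inj_on g R" and g: "g ` R \<subseteq> Pow I"
  shows "separating_family V (insert R (reorient R g ` I))"
proof -
  note RD = TourD[OF R]
  have "\<exists>\<tau>\<in>insert R (reorient R g ` I). separates \<tau> (a, b) (c, d)"
    if ab: "a \<in> V" "b \<in> V" "a \<noteq> b" and cd: "c \<in> V" "d \<in> V" "c \<noteq> d"
      and ne: "(a, b) \<noteq> (c, d)" for a b c d
  proof (cases "(a, b) \<in> R \<longleftrightarrow> (c, d) \<in> R")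
    case False
    then have "separates R (a, b) (c, d)" by (simp add: separates_def)
    then show ?thesis by blast
  next
    case same: True
    show ?thesis
    proof (cases "(a, b) \<in> R")
      case True
      with same ne inj have "g (a, b) \<noteq> g (c, d)" by (auto dest: inj_onD)
      with g True same obtain i where i: "i \<in> I" "i \<in> g (a, b) \<longleftrightarrow> i \<notin> g (c, d)" by blast
      \<comment> \<open>This rules out the converse half of \<open>reorient\<close>, so that
        membership of these arcs is decided by \<open>g\<close> alone.\<close>
      have "(b, a) \<notin> R" "(d, c) \<notin> R" using True same RD(3) ab cd by blast+
      with i True same have "separates (reorient R g i) (a, b) (c, d)"
        by (auto simp: separates_def reorient_def)
      with i show ?thesis by blast
    next
      case False
      with same have ba: "(b, a) \<in> R" "(d, c) \<in> R" using RD(3) ab cd by blast+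
      with ne inj have "g (b, a) \<noteq> g (d, c)" by (auto dest: inj_onD)
      with g ba obtain i where i: "i \<in> I" "i \<in> g (b, a) \<longleftrightarrow> i \<notin> g (d, c)" by blast
      with False same ba have "separates (reorient R g i) (a, b) (c, d)"
        by (auto simp: separates_def reorient_def)
      with i show ?thesis by blast
    qed
  qed
  then show ?thesis
    using R reorient_Tour[OF R] unfolding separating_family_def by auto
qed

lemma separating_family_exists:
  assumes R: "R \<in> Tour V" and le: "|R| \<le>o |Pow I|"
  shows "\<exists>f. separating_family V (insert R (f ` I))"
proof -
  obtain g where "inj_on g R" "g ` R \<subseteq> Pow I"
    using le unfolding card_of_ordLeq[symmetric] by blast
  from separating_family_reorient[OF R this] show ?thesis by blast
qed

section \<open>Finite cardinals\<close>

lemma card_pairs: "finite V \<Longrightarrow> card (V \<times> V - Id) = card V * (card V - 1)"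
proof -
  assume fin: "finite V"
  have "V \<times> V - Id = (SIGMA x:V. V - {x})" by auto
  then show ?thesis using fin by (simp add: card_Diff_singleton)
qed

text \<open>\<open>R\<close> and its converse partition the pairs. The factor 2 is what saves one
  index in the upper bound.\<close>

lemma card_pairs_Tour:
  assumes "finite V" "R \<in> Tour V"
  shows "card (V \<times> V - Id) = 2 * card R"
proof -
  note R = TourD[OF assms(2)]
  have "finite R" using finite_subset[OF R(1)] assms(1) by simp
  moreover have "V \<times> V - Id = R \<union> R\<inverse>" "R \<inter> R\<inverse> = {}" using R by auto
  ultimately show ?thesis by (simp add: card_Un_disjoint card_inverse)
qed

text \<open>Turns the rounded logarithm into the least exponent whose power of 2 reaches
  \<open>N\<close>, the form in which both counting bounds arise.\<close>

lemma le_two_power_iff_ceiling_log: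
  fixes N m :: nat
  assumes "N > 0"
  shows "nat \<lceil>log 2 N\<rceil> \<le> m \<longleftrightarrow> N \<le> 2 ^ m"
proof -
  have "nat \<lceil>log 2 N\<rceil> \<le> m \<longleftrightarrow> log 2 N \<le> m"
    by (simp add: nat_le_iff ceiling_le_iff)
  also have "\<dots> \<longleftrightarrow> real N \<le> 2 powr m"
    using assms by (simp add: log_le_iff)
  also have "\<dots> \<longleftrightarrow> N \<le> 2 ^ m"
    by (simp add: powr_realpow)
  finally show ?thesis .
qed

lemma h_Tour_finite:
  fixes \<kappa> :: "'a rel"
  assumes \<kappa>: "Card_order \<kappa>" and n: "\<kappa> =o |{..<n::nat}|"
  shows "h_Tour \<kappa> =o |{..<nat \<lceil>log 2 (real n * (real n - 1))\<rceil>}|"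
proof -
  define N where "N = n * (n - 1)"
  define m where "m = nat \<lceil>log 2 N\<rceil>"
  \<comment> \<open>Truncated subtraction does no harm at \<open>n = 0\<close>, where both products
    vanish.\<close>
  have N: "real n * (real n - 1) = real N" by (cases n) (auto simp: N_def algebra_simps)
  have V: "finite V \<and> card V = n" if "|V :: 'a set| =o \<kappa>" for V
  proof -
    have "|V| =o |{..<n}|" using that n by (rule ordIso_transitive)
    then obtain f where "bij_betw f V {..<n}" using card_of_ordIso by blast
    then show ?thesis using bij_betw_finite bij_betw_same_card by fastforce
  qed
  obtain V X where VX: "|V :: 'a set| =o \<kappa>" "separating_family V X" "|X| =o h_Tour \<kappa>"
    using h_Tour_props(2)[OF \<kappa>] by blast
  have fV: "finite V" "card V = n" using V[OF VX(1)] by auto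
  obtain R where R: "R \<in> Tour V" using Tour_nonempty by blast
  have cR: "2 * card R = N"
    using card_pairs_Tour[OF fV(1) R] card_pairs[OF fV(1)] fV(2) by (simp add: N_def)
  have fR: "finite R" using finite_subset[OF TourD(1)[OF R]] fV by simp
  have "X \<subseteq> Pow (V \<times> V)" using VX(2) by (auto simp: separating_family_def Tour_def)
  then have fX: "finite X" using fV(1) finite_subset by fastforce
  have "m \<le> card X"
  proof (cases "N = 0")
    case True
    \<comment> \<open>The convention \<open>log 2 0 = 0\<close> makes \<open>m = 0\<close>.\<close>
    then show ?thesis by (simp add: m_def log_def)
  next
    case False
    have "\<exists>f. inj_on f (V \<times> V - Id) \<and> f ` (V \<times> V - Id) \<subseteq> Pow X"
      using separating_family_pairs_ordLeq_Pow[OF VX(2)] by (simp add: card_of_ordLeq)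
    then have "card (V \<times> V - Id) \<le> card (Pow X)"
      using card_inj_on_le fX by blast
    then have "N \<le> 2 ^ card X"
      using card_pairs[OF fV(1)] fV(2) fX by (simp add: N_def card_Pow)
    then show ?thesis
      unfolding m_def using False by (intro iffD2[OF le_two_power_iff_ceiling_log]) auto
  qed
  then have "\<exists>f. inj_on f {..<m} \<and> f ` {..<m} \<subseteq> X"
    using inj_on_iff_card_le[of "{..<m}" X] fX by simp
  then have "|{..<m}| \<le>o |X|" by (simp add: card_of_ordLeq)
  then have lower: "|{..<m}| \<le>o h_Tour \<kappa>" using VX(3) by (rule ordLeq_ordIso_trans)
  have "\<exists>Y. separating_family V Y \<and> finite Y \<and> card Y \<le> m"
  proof (cases "N = 0")
    case True
    then have "V \<times> V - Id = {}"
      using card_pairs[OF fV(1)] fV card_eq_0_iff[of "V \<times> V - Id"] by (simp add: N_def)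
    \<comment> \<open>Here \<open>m = 0\<close>, so even the single tournament \<open>R\<close>
      would be one too many.\<close>
    then have "separating_family V {}" unfolding separating_family_def by blast
    then show ?thesis by (intro exI[of _ "{}"]) simp
  next
    case False
    have Nm: "N \<le> 2 ^ m" using False le_two_power_iff_ceiling_log[of N m] by (simp add: m_def)
    \<comment> \<open>\<open>N\<close> is even and positive, hence at least 2, which excludes
      \<open>m = 0\<close>. Halving \<open>N \<le> 2 ^ m\<close> then leaves room for the codes of
      \<open>R\<close> in the subsets of \<open>k\<close> indices, and \<open>R\<close> brings the
      family to at most \<open>k + 1 = m\<close> members.\<close>
    with cR False obtain k where k: "m = Suc k" by (cases m) auto
    have "card R \<le> card (Pow {..<k})" using Nm cR k by (simp add: card_Pow)
    then have "\<exists>f. inj_on f R \<and> f ` R \<subseteq> Pow {..<k}"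
      using inj_on_iff_card_le[OF fR, of "Pow {..<k}"] by simp
    then have "|R| \<le>o |Pow {..<k}|" by (simp add: card_of_ordLeq)
    then obtain f where "separating_family V (insert R (f ` {..<k}))"
      using separating_family_exists[OF R] by blast
    moreover have "card (insert R (f ` {..<k})) \<le> Suc k"
      using card_insert_le_m1[of "Suc k"] card_image_le[of "{..<k}" f] by simp
    ultimately show ?thesis using k by blast
  qed
  then obtain Y where Y: "separating_family V Y" "finite Y" "card Y \<le> m" by blast
  have "\<exists>f. inj_on f Y \<and> f ` Y \<subseteq> {..<m}"
    using inj_on_iff_card_le[OF Y(2), of "{..<m}"] Y(3) by simp
  then have "|Y| \<le>o |{..<m}|" by (simp add: card_of_ordLeq)
  with h_Tour_props(3)[OF \<kappa> VX(1) Y(1)] have "h_Tour \<kappa> \<le>o |{..<m}|"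
    by (rule ordLeq_transitive)
  with lower show ?thesis unfolding N m_def[symmetric] by (simp add: ordIso_iff_ordLeq)
qed

section \<open>Infinite cardinals\<close>

lemma ctwo_cexp_ordIso_Pow: "ctwo ^c \<mu> =o |Pow (Field \<mu>)|"
  using card_of_Pow_Func[of "Field \<mu>"] unfolding cexp_def ctwo_def Field_card_of
  by (rule ordIso_symmetric)

lemma h_Tour_infinite:
  fixes \<kappa> :: "'a rel"
  assumes \<kappa>: "Card_order \<kappa>" and inf: "cinfinite \<kappa>"
  shows "h_Tour \<kappa> =o log2_card \<kappa>"
proof -
  obtain V X where VX: "|V :: 'a set| =o \<kappa>" "separating_family V X" "|X| =o h_Tour \<kappa>"
    using h_Tour_props(2)[OF \<kappa>] by blast
  have "|Field \<kappa>| =o |V|"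
    using card_of_Field_ordIso[OF \<kappa>] ordIso_symmetric[OF VX(1)] by (rule ordIso_transitive)
  then have infV: "infinite V" using inf card_of_ordIso_finite unfolding cinfinite_def by blast
  then obtain v where v: "v \<in> V" using infinite_imp_nonempty by blast
  \<comment> \<open>The pairs with first entry \<open>v\<close> alone already number
    \<open>\<kappa>\<close>, because removing one point does not change the size of an infinite
    set.\<close>
  have "inj_on (Pair v) (V - {v})" "Pair v ` (V - {v}) \<subseteq> V \<times> V - Id"
    using v by (auto intro: inj_onI)
  then have "|V - {v}| \<le>o |V \<times> V - Id|" using card_of_ordLeq by blast
  then have VX': "|V - {v}| \<le>o |Pow X|"
    using separating_family_pairs_ordLeq_Pow[OF VX(2)] by (rule ordLeq_transitive)
  have "|V| =o |V - {v}|" using infinite_imp_bij_betw[OF infV] card_of_ordIso by blast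
  with ordIso_symmetric[OF VX(1)] have "\<kappa> =o |V - {v}|" by (rule ordIso_transitive)
  then have \<kappa>X: "\<kappa> \<le>o |Pow X|" using VX' by (rule ordIso_ordLeq_trans)
  have "log2_card \<kappa> \<le>o |X|"
  proof (cases "\<kappa> \<le>o |X|")
    case True
    \<comment> \<open>By Cantor, \<open>\<kappa>\<close> itself competes in the minimum defining
      \<open>log2_card \<kappa>\<close>.\<close>
    have "\<kappa> \<le>o ctwo ^c \<kappa>" using ordLess_ctwo_cexp[OF \<kappa>] ordLess_imp_ordLeq by blast
    from log2_card_props(3)[OF \<kappa> \<kappa> this] True show ?thesis by (rule ordLeq_transitive)
  next
    case False
    \<comment> \<open>Minimality of \<open>log2_card\<close> speaks about cardinals of type \<open>'a\<close> only, so a copy of \<open>X\<close> in \<open>'a\<close>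
      is needed.\<close>
    then have "|X| \<le>o \<kappa>"
      using ordLeq_total[OF card_order_on_well_order_on[OF \<kappa>] card_of_Well_order[of X]] by blast
    then have "|X| \<le>o |Field \<kappa>|"
      using ordIso_symmetric[OF card_of_Field_ordIso[OF \<kappa>]] by (rule ordLeq_ordIso_trans)
    then obtain f where f: "inj_on f X" "f ` X \<subseteq> Field \<kappa>"
      unfolding card_of_ordLeq[symmetric] by blast
    define Z where "Z = f ` X"
    have bij: "bij_betw f X Z" using f(1) unfolding Z_def by (rule inj_on_imp_bij_betw)
    then have XZ: "|X| =o |Z|" using card_of_ordIso by blast
    have PowXZ: "|Pow X| =o |Pow Z|" using bij_betw_Pow[OF bij] card_of_ordIso by blast
    have "|Pow Z| =o ctwo ^c |Z|"
      using ordIso_symmetric[OF ctwo_cexp_ordIso_Pow[of "|Z|"]] by (simp add: Field_card_of)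
    with PowXZ have "|Pow X| =o ctwo ^c |Z|" by (rule ordIso_transitive)
    with \<kappa>X have "\<kappa> \<le>o ctwo ^c |Z|" by (rule ordLeq_ordIso_trans)
    then have "log2_card \<kappa> \<le>o |Z|" by (rule log2_card_props(3)[OF \<kappa> card_of_Card_order])
    then show ?thesis using ordIso_symmetric[OF XZ] by (rule ordLeq_ordIso_trans)
  qed
  then have lower: "log2_card \<kappa> \<le>o h_Tour \<kappa>" using VX(3) by (rule ordLeq_ordIso_trans)
  define I where "I = Field (log2_card \<kappa>)"
  have I: "|I| =o log2_card \<kappa>"
    unfolding I_def by (rule card_of_Field_ordIso[OF log2_card_props(1)[OF \<kappa>]])
  have VI: "|V| \<le>o |Pow I|"
    unfolding I_def
    by (rule ordLeq_ordIso_trans[OF ordIso_ordLeq_trans[OF VX(1) log2_card_props(2)[OF \<kappa>]]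
          ctwo_cexp_ordIso_Pow])
  \<comment> \<open>A finite \<open>I\<close> would have a finite power set, too small for
    \<open>V\<close>. Infinity of \<open>I\<close> lets the extra member \<open>R\<close> be
    absorbed below.\<close>
  then have infI: "infinite I" using card_of_ordLeq_infinite[OF VI infV] by simp
  obtain R where R: "R \<in> Tour V" using Tour_nonempty by blast
  have "|R| \<le>o |V \<times> V|" using TourD(1)[OF R] by (rule card_of_mono1)
  then have "|R| \<le>o |V|"
    using card_of_Times_same_infinite[OF infV] by (rule ordLeq_ordIso_trans)
  then have "|R| \<le>o |Pow I|" using VI by (rule ordLeq_transitive)
  then obtain f where "separating_family V (insert R (f ` I))"
    using separating_family_exists[OF R] by blast
  then have "h_Tour \<kappa> \<le>o |insert R (f ` I)|" by (rule h_Tour_props(3)[OF \<kappa> VX(1)])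
  moreover have "|insert R (f ` I)| \<le>o |I|"
  proof -
    have "|{R}| \<le>o |I|" using infI by (intro card_of_singl_ordLeq) auto
    then have "|{R} \<union> f ` I| \<le>o |I|"
      using infI
      by (intro card_of_Un_ordLeq_infinite_Field card_of_image card_of_Card_order)
        (simp_all add: Field_card_of)
    then show ?thesis by simp
  qed
  ultimately have "h_Tour \<kappa> \<le>o |I|" by (rule ordLeq_transitive)
  then have "h_Tour \<kappa> \<le>o log2_card \<kappa>" using I by (rule ordLeq_ordIso_trans)
  with lower show ?thesis by (simp add: ordIso_iff_ordLeq)
qed

theorem theorem3:
  fixes \<kappa> :: "'a rel"
  assumes "Card_order \<kappa>"
  shows "(cinfinite \<kappa> \<longrightarrow> h_Tour \<kappa> =o log2_card \<kappa>) \<and>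
         (\<forall>n::nat. \<kappa> =o |{..<n}| \<longrightarrow>
            h_Tour \<kappa> =o |{..<nat \<lceil>log 2 (real n * (real n - 1))\<rceil>}| )"
  by (intro conjI impI allI h_Tour_infinite[OF assms] h_Tour_finite[OF assms])

end
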